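(* Let $\mathcal{C}$ be the class of all finite simple subcubic graphs. Then the indeque ratio of $\mathcal{C}$ exists and equals one half: $${}^{\alpha}_{\omega}(\mathcal{C})=\lim_{n\to\infty}\frac{{}^{\alpha}_{\omega}(\mathcal{C},n)}{n}=\frac{1}{2}.$$
   Context: All graphs are finite and simple. A graph is subcubic if its maximum degree is at most three. For a graph $G$ and $S\subseteq V(G)$, let $G[S]$ denote the subgraph of $G$ induced by $S$. The set $S$ is an indeque set of $G$ if every connected component of $G[S]$ is a complete graph (a clique). The indeque number of $G$ is the maximum number of vertices in an indeque set, ${}^{\alpha}_{\omega}(G)=\max\{|S| : S\subseteq V(G),\ S \text{ is an indeque set of } G\}$. For a class $\mathcal{G}$ of graphs, ${}^{\alpha}_{\omega}(\mathcal{G},n)=\min\{{}^{\alpha}_{\omega}(G) : G\in\mathcal{G},\ |V(G)|=n\}$, and the indeque ratio of $\mathcal{G}$ is ${}^{\alpha}_{\omega}(\mathcal{G})=\lim_{n\to\infty}{}^{\alpha}_{\omega}(\mathcal{G},n)/n$. *)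

theory Defs
  imports "Graph_Theory.Graph_Theory" Complex_Main
begin

text \<open>
  As in the Graph_Theory entry, a finite simple graph is a symmetric loopfree finite digraph
  whose arcs are pairs of vertices (\<open>pair_graph\<close>); each undirected edge is the two arcs
  \<open>(u, v)\<close> and \<open>(v, u)\<close>.
\<close>

text \<open>
  \<open>Digraph_Component.connected\<close> requires a nonempty vertex set, so the empty graph has no
  components.
\<close>
definition component_of :: "('a, 'b) pre_digraph \<Rightarrow> ('a, 'b) pre_digraph \<Rightarrow> bool" where
  "component_of H G \<longleftrightarrow> pre_digraph.max_subgraph G Digraph_Component.connected H"

definition indeque_set :: "'a pair_pre_digraph \<Rightarrow> 'a set \<Rightarrow> bool" where
  "indeque_set G S \<longleftrightarrow> S \<subseteq> pverts G \<and>
     (\<forall>H. component_of H (with_proj G \<restriction> S) \<longrightarrow> (\<exists>k. complete_digraph k H))"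

definition indeque_number :: "'a pair_pre_digraph \<Rightarrow> nat" where
  "indeque_number G = Max {card S |S. indeque_set G S}"

text \<open>
  If the class has no graph of order \<open>n\<close>, the value is the unspecified \<open>Min {}\<close>. For a class of
  finite graphs the set is bounded by \<open>n\<close>, hence finite.
\<close>
definition class_indeque_number :: "'a pair_pre_digraph set \<Rightarrow> nat \<Rightarrow> nat" where
  "class_indeque_number \<G> n = Min {indeque_number G |G. G \<in> \<G> \<and> card (pverts G) = n}"

text \<open>Meaningful only if the limit exists.\<close>
definition indeque_ratio :: "'a pair_pre_digraph set \<Rightarrow> real" where
  "indeque_ratio \<G> = lim (\<lambda>n. real (class_indeque_number \<G> n) / real n)"

text \<open>In a symmetric digraph the out-degree of a vertex is its degree as an undirected graph.\<close>
definition subcubic :: "'a pair_pre_digraph \<Rightarrow> bool" where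
  "subcubic G \<longleftrightarrow> (\<forall>v \<in> pverts G. out_degree (with_proj G) v \<le> 3)"

text \<open>
  Vertices are natural numbers: every finite graph is isomorphic to such a graph, and the indeque
  number is invariant under isomorphism.
\<close>
definition subcubic_graphs :: "nat pair_pre_digraph set" where
  "subcubic_graphs = {G. pair_graph G \<and> subcubic G}"

end

theory Submission
  imports Defs
begin

text \<open>
  For graphs in which adjacency is symmetric, all components of \<open>G[S]\<close> are cliques iff \<open>G[S]\<close> has
  no induced path on three vertices: inside a component any two vertices are joined by a walk, and
  without induced paths of length two a walk can be shortened to a single edge. Both bounds on the
  indeque number use this local description (\<open>indeque_set_iff\<close>).

  Lower bound. In a maximum cut of a subcubic graph every vertex has at least as many neighbours
  across the cut as on its own side, so at most one of its at most three neighbours is on its own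
  side. Hence both sides induce a disjoint union of single vertices and single edges, and the larger
  one is an indeque set containing at least half of the vertices
  (\<open>card_le_twice_indeque_number\<close>).

  Upper bound. An indeque set meets a copy of \<open>K\<^sub>3\<^sub>,\<^sub>3\<close> in at most three vertices, since as soon
  as it uses both sides it consists of the two ends of an edge. Disjoint copies of \<open>K\<^sub>3\<^sub>,\<^sub>3\<close>,
  the last one truncated to reach an arbitrary order \<open>n\<close>, therefore have indeque number at most
  \<open>n/2 + 3\<close> (\<open>indeque_number_K33_blocks\<close>). Dividing both bounds by \<open>n\<close> gives the limit.
\<close>

section \<open>Indeque sets as sets without induced paths on three vertices\<close>

text \<open>
  For symmetric digraphs connectedness may be replaced by strong connectedness, for which the theory
  of components is developed. A connected subgraph need not itself be symmetric, but a maximal one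
  is induced and therefore is.
\<close>
lemma component_of_iff_sccs:
  assumes "sym_digraph G"
  shows "component_of H G \<longleftrightarrow> H \<in> pre_digraph.sccs G"
proof -
  interpret sym_digraph G by fact
  have induced_strong: "strongly_connected K"
    if "induced_subgraph K G" "Digraph_Component.connected K" for K
  proof -
    interpret K: sym_digraph K using that(1) by (rule induced_graph_imp_graph)
    show ?thesis using K.sym_arcs that(2) by (rule K.symmetric_connected_imp_strongly_connected)
  qed
  have strong_conn: "Digraph_Component.connected K"
    if "subgraph K G" "strongly_connected K" for K
    using that unfolding connected_def strongly_connected_def
    by (metis pverts_mk_symmetric subgraphE wf_digraph.reachable_mk_symmetricI with_proj_simps(1))
  have mono: "arc_mono Digraph_Component.connected"
    unfolding arc_mono_def
    by (metis spanning_def subgraphE wf_digraph.connected_spanning_imp_connected)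
  show ?thesis
    unfolding component_of_def sccs_altdef2 mem_Collect_eq
  proof
    assume max: "max_subgraph Digraph_Component.connected H"
    have sc: "strongly_connected H"
      using induced_strong induced_subgraphI_arc_mono[OF max mono] max_subgraph_prop[OF max] by blast
    show "max_subgraph strongly_connected H"
      using max sc strong_conn unfolding max_subgraph_def by blast
  next
    assume max: "max_subgraph strongly_connected H"
    then have sub: "subgraph H G" and sc: "strongly_connected H"
      by (auto simp: max_subgraph_def)
    show "max_subgraph Digraph_Component.connected H"
    proof (rule max_subgraphI)
      show "Digraph_Component.connected H" using sub sc by (rule strong_conn)
      show "subgraph H G" by fact
    next
      fix K assume "H \<noteq> K" and HK: "subgraph H K" and KG: "subgraph K G"
      show "\<not> Digraph_Component.connected K"
      proof
        assume conn: "Digraph_Component.connected K"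
        let ?I = "G \<restriction> verts K"
        have ind: "induced_subgraph ?I G" using KG by (intro induced_induce) auto
        have KI: "subgraph K ?I" using KG by (rule subgraph_induce_subgraphI2)
        have "Digraph_Component.connected ?I"
          using mono conn KI unfolding arc_mono_def by (metis induce_subgraph_verts)
        then have "strongly_connected ?I" using ind by (rule induced_strong[rotated])
        moreover have "subgraph H ?I" using HK KI by (rule subgraph_trans)
        ultimately have "H = ?I"
          using max induced_imp_subgraph[OF ind] unfolding max_subgraph_def by metis
        then have "H = K" using HK KI by (auto simp: subgraph_def compatible_def)
        then show False using \<open>H \<noteq> K\<close> by simp
      qed
    qed
  qed
qed

lemma indeque_set_iff:
  assumes "pair_graph G"
  shows "indeque_set G S \<longleftrightarrow> S \<subseteq> pverts G \<and>
    (\<forall>u\<in>S. \<forall>v\<in>S. \<forall>w\<in>S. (u, v) \<in> parcs G \<and> (v, w) \<in> parcs G \<and> u \<noteq> w \<longrightarrow> (u, w) \<in> parcs G)"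
    (is "_ \<longleftrightarrow> _ \<and> ?P3")
proof (cases "S \<subseteq> pverts G")
  case False
  then show ?thesis by (simp add: indeque_set_def)
next
  case True
  interpret G: pair_graph G by fact
  let ?I = "with_proj G \<restriction> S"
  have ind: "induced_subgraph ?I (with_proj G)" using True by (intro G.induced_induce) simp
  interpret I: digraph ?I using ind by (rule G.digraphI_induced)
  interpret I: sym_digraph ?I using ind by (rule G.induced_graph_imp_graph)
  have ends: "arcs_ends ?I = {(u, v) \<in> parcs G. u \<in> S \<and> v \<in> S}"
    by (auto simp: arcs_ends_conv image_iff)
  note comp = component_of_iff_sccs[OF I.sym_digraph_axioms]
  have "(\<forall>H. component_of H ?I \<longrightarrow> (\<exists>k. complete_digraph k H)) \<longleftrightarrow> ?P3"
  proof
    assume clique: "\<forall>H. component_of H ?I \<longrightarrow> (\<exists>k. complete_digraph k H)"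
    show ?P3
    proof (intro ballI impI)
      fix u v w
      assume S: "u \<in> S" "v \<in> S" "w \<in> S"
        and path: "(u, v) \<in> parcs G \<and> (v, w) \<in> parcs G \<and> u \<noteq> w"
      let ?C = "?I \<restriction> {x. u \<rightarrow>\<^sup>*\<^bsub>?I\<^esub> x}"
      have "?C \<in> I.sccs" using S by (intro I.induce_reachable_is_in_sccs) simp
      then obtain k where "complete_digraph k ?C" using clique comp by blast
      moreover have "u \<rightarrow>\<^sup>*\<^bsub>?I\<^esub> u" using S by (intro I.reachable_refl) simp
      moreover have "u \<rightarrow>\<^bsub>?I\<^esub> v" "v \<rightarrow>\<^bsub>?I\<^esub> w" using S path ends by auto
      then have "u \<rightarrow>\<^sup>*\<^bsub>?I\<^esub> w" by (meson I.reachable_adjI I.reachable_trans)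
      ultimately have "u \<rightarrow>\<^bsub>?C\<^esub> w" using path by (auto simp: complete_digraph_def)
      then have "u \<rightarrow>\<^bsub>?I\<^esub> w" by (rule dominates_induce_subgraphD)
      then show "(u, w) \<in> parcs G" using ends by auto
    qed
  next
    assume P3: ?P3
    show "\<forall>H. component_of H ?I \<longrightarrow> (\<exists>k. complete_digraph k H)"
    proof (intro allI impI)
      fix H assume "component_of H ?I"
      then have "H \<in> I.sccs" using comp by simp
      then have H: "induced_subgraph H ?I" and sc: "strongly_connected H" by auto
      interpret H: digraph H using H by (rule I.digraphI_induced)
      interpret H: sym_digraph H using H by (rule I.induced_graph_imp_graph)
      have verts: "verts H \<subseteq> S"
        using subgraph_imp_subverts[OF induced_imp_subgraph[OF H]] by simp
      have Hends: "arcs_ends H = {(u, v) \<in> parcs G. u \<in> verts H \<and> v \<in> verts H}"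
        using H verts
        by (auto simp: induced_subgraph_def subgraph_def compatible_def arcs_ends_conv image_iff)
      have adj: "u = v \<or> (u, v) \<in> parcs G" if "u \<rightarrow>\<^sup>*\<^bsub>H\<^esub> v" for u v
        using that
      proof (induction rule: H.reachable_induct)
        case base
        then show ?case by simp
      next
        case (step x y)
        then have "x \<in> S" "y \<in> S" "u \<in> S" "(x, y) \<in> parcs G"
          using verts Hends H.reachable_in_verts by blast+
        then show ?case using step.IH P3 by blast
      qed
      have "arcs_ends H = {(u, v). (u, v) \<in> verts H \<times> verts H \<and> u \<noteq> v}"
        using adj sc G.no_loops' unfolding Hends strongly_connected_def by blast
      moreover have "graph H" by unfold_locales
      ultimately show "\<exists>k. complete_digraph k H" by (auto simp: complete_digraph_def)
    qed
  qed
  then show ?thesis using True by (simp add: indeque_set_def)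
qed

lemma indeque_set_empty:
  assumes "pair_graph G"
  shows "indeque_set G {}"
  using assms by (simp add: indeque_set_iff)

lemma finite_indeque_cards:
  assumes "finite (pverts G)"
  shows "finite {card S |S. indeque_set G S}"
proof (rule finite_subset)
  show "{card S |S. indeque_set G S} \<subseteq> card ` Pow (pverts G)"
    by (auto simp: indeque_set_def)
qed (simp add: assms)

lemma card_le_indeque_number:
  assumes "finite (pverts G)" "indeque_set G S"
  shows "card S \<le> indeque_number G"
  unfolding indeque_number_def
  using assms by (intro Max_ge finite_indeque_cards) auto

lemma indeque_number_le:
  assumes "pair_graph G" "\<And>S. indeque_set G S \<Longrightarrow> card S \<le> k"
  shows "indeque_number G \<le> k"
proof -
  interpret pair_graph G by fact
  show ?thesis
    unfolding indeque_number_def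
    using assms indeque_set_empty[OF assms(1)]
    by (intro Max.boundedI finite_indeque_cards) (auto simp: pair_finite_verts)
qed

section \<open>Maximum cuts of subcubic graphs\<close>

definition cut_arcs :: "'a pair_pre_digraph \<Rightarrow> 'a set \<Rightarrow> ('a \<times> 'a) set" where
  "cut_arcs G A = {(u, v) \<in> parcs G. u \<in> A \<and> v \<notin> A}"

lemma (in pair_graph) card_cut_arcs_complement:
  "card (cut_arcs G (pverts G - A)) = card (cut_arcs G A)"
proof -
  have "cut_arcs G (pverts G - A) = prod.swap ` cut_arcs G A"
    using arcs_symmetric wellformed' unfolding cut_arcs_def image_def by fastforce
  then show ?thesis by (simp add: card_image)
qed

text \<open>
  Moving \<open>v\<close> to the other side removes the arcs from \<open>v\<close> across the cut and adds those joining its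
  former side to \<open>v\<close>. Since the cut does not grow, at most half of the neighbours of \<open>v\<close>, hence at
  most one, lie on its own side.
\<close>
lemma (in pair_graph) max_cut_inner_degree:
  assumes max: "\<And>B. B \<subseteq> pverts G \<Longrightarrow> card (cut_arcs G B) \<le> card (cut_arcs G A)"
    and A: "A \<subseteq> pverts G" and v: "v \<in> A" and sub: "subcubic G"
  shows "card {w \<in> A. (v, w) \<in> parcs G} \<le> 1"
proof -
  let ?in = "{w \<in> A. (v, w) \<in> parcs G}" and ?out = "{w. (v, w) \<in> parcs G \<and> w \<notin> A}"
  let ?rest = "{(u, w) \<in> parcs G. u \<in> A - {v} \<and> w \<notin> A}"
  have fin: "finite ?in" "finite ?out"
    by (rule finite_subset[OF _ pair_finite_verts]; auto dest: wellformed')+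
  have fin_rest: "finite ?rest" by (rule finite_subset[OF _ pair_finite_arcs]) auto
  have old: "cut_arcs G A = ?rest \<union> Pair v ` ?out"
    using v by (auto simp: cut_arcs_def)
  have card_old: "card (?rest \<union> Pair v ` ?out) = card ?rest + card ?out"
    using fin fin_rest by (subst card_Un_disjoint) (auto simp: card_image inj_on_def)
  have new: "cut_arcs G (A - {v}) = ?rest \<union> (\<lambda>w. (w, v)) ` ?in"
  proof (rule set_eqI)
    fix e :: "'a \<times> 'a"
    obtain a b where e: "e = (a, b)" by fastforce
    have "(a, v) \<in> parcs G \<longleftrightarrow> (v, a) \<in> parcs G" using arcs_symmetric by blast
    then show "e \<in> cut_arcs G (A - {v}) \<longleftrightarrow> e \<in> ?rest \<union> (\<lambda>w. (w, v)) ` ?in"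
      using v no_loops'[of v v] by (cases "a = v"; cases "b = v") (auto simp: cut_arcs_def e)
  qed
  have card_new: "card (?rest \<union> (\<lambda>w. (w, v)) ` ?in) = card ?rest + card ?in"
    using fin fin_rest v by (subst card_Un_disjoint) (auto simp: card_image inj_on_def)
  have "A - {v} \<subseteq> pverts G" using A by blast
  then have "card ?in \<le> card ?out"
    using max[of "A - {v}"] unfolding old new card_old card_new by linarith
  moreover have "card ?in + card ?out \<le> 3"
  proof -
    have "out_arcs (with_proj G) v = Pair v ` (?in \<union> ?out)"
      by (auto simp: out_arcs_def image_iff)
    then have "out_degree (with_proj G) v = card (?in \<union> ?out)"
      by (simp add: out_degree_def card_image inj_on_def)
    moreover have "card (?in \<union> ?out) = card ?in + card ?out"
      using fin by (subst card_Un_disjoint) auto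
    moreover have "out_degree (with_proj G) v \<le> 3"
      using sub v A by (auto simp: subcubic_def)
    ultimately show ?thesis by simp
  qed
  ultimately show ?thesis by linarith
qed

text \<open>
  With inner degree at most one, the two ends of a path on three vertices would be two neighbours
  of its middle vertex on the same side.
\<close>
lemma (in pair_graph) indeque_set_max_cut:
  assumes max: "\<And>B. B \<subseteq> pverts G \<Longrightarrow> card (cut_arcs G B) \<le> card (cut_arcs G A)"
    and A: "A \<subseteq> pverts G" and sub: "subcubic G"
  shows "indeque_set G A"
  unfolding indeque_set_iff[OF pair_graph]
proof (intro conjI ballI impI A)
  fix u v w
  assume A': "u \<in> A" "v \<in> A" "w \<in> A"
    and path: "(u, v) \<in> parcs G \<and> (v, w) \<in> parcs G \<and> u \<noteq> w"
  have "finite {x \<in> A. (v, x) \<in> parcs G}"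
    using finite_subset[OF A pair_finite_verts] by simp
  moreover have "{u, w} \<subseteq> {x \<in> A. (v, x) \<in> parcs G}"
    using A' path arcs_symmetric[of u v] by auto
  ultimately have "card {u, w} \<le> card {x \<in> A. (v, x) \<in> parcs G}" by (rule card_mono)
  also have "\<dots> \<le> 1" using max A A'(2) sub by (rule max_cut_inner_degree)
  finally show "(u, w) \<in> parcs G" using path by simp
qed

lemma card_le_twice_indeque_number:
  assumes "pair_graph G" "subcubic G"
  shows "card (pverts G) \<le> 2 * indeque_number G"
proof -
  interpret pair_graph G by fact
  let ?cuts = "(\<lambda>A. card (cut_arcs G A)) ` Pow (pverts G)"
  have fin: "finite ?cuts" by (simp add: pair_finite_verts)
  have "Max ?cuts \<in> ?cuts" using fin by (intro Max_in) auto
  then obtain A where A: "A \<subseteq> pverts G" and "card (cut_arcs G A) = Max ?cuts" by auto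
  then have max: "\<And>B. B \<subseteq> pverts G \<Longrightarrow> card (cut_arcs G B) \<le> card (cut_arcs G A)"
    using fin by (auto intro: Max_ge)
  have "indeque_set G A" using max A assms(2) by (rule indeque_set_max_cut)
  moreover have "indeque_set G (pverts G - A)"
    using max assms(2) by (intro indeque_set_max_cut) (auto simp: card_cut_arcs_complement)
  ultimately have "card A \<le> indeque_number G" "card (pverts G - A) \<le> indeque_number G"
    using pair_finite_verts by (auto intro: card_le_indeque_number)
  moreover have "card (pverts G) = card A + card (pverts G - A)"
    using A pair_finite_verts by (metis card_Diff_subset card_mono finite_subset le_add_diff_inverse)
  ultimately show ?thesis by simp
qed

section \<open>Disjoint copies of the complete bipartite graph on three and three vertices\<close>

text \<open>
  Each block of six consecutive numbers carries a copy of \<open>K\<^sub>3\<^sub>,\<^sub>3\<close> whose two sides are the even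
  and the odd numbers; the last block may be cut off.
\<close>
definition K33_blocks :: "nat \<Rightarrow> nat pair_pre_digraph" where
  "K33_blocks n = \<lparr>pverts = {..<n},
    parcs = {(i, j). i < n \<and> j < n \<and> i div 6 = j div 6 \<and> even i \<noteq> even j}\<rparr>"

lemma pverts_K33_blocks [simp]: "pverts (K33_blocks n) = {..<n}"
  by (simp add: K33_blocks_def)

lemma parcs_K33_blocks [simp]:
  "parcs (K33_blocks n) = {(i, j). i < n \<and> j < n \<and> i div 6 = j div 6 \<and> even i \<noteq> even j}"
  by (simp add: K33_blocks_def)

lemma pair_graph_K33_blocks: "pair_graph (K33_blocks n)"
proof
  show "finite (parcs (K33_blocks n))"
    by (rule finite_subset[of _ "{..<n} \<times> {..<n}"]) auto
qed (auto simp: symmetric_def intro!: symI)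

lemma block_parity_subset:
  "{j. j div 6 = q \<and> even j} \<subseteq> {6 * q, 6 * q + 2, 6 * q + (4::nat)}"
  "{j. j div 6 = q \<and> odd j} \<subseteq> {6 * q + 1, 6 * q + 3, 6 * q + (5::nat)}"
  by auto presburger+

lemma card_block_parity:
  "finite {j. j div 6 = (q::nat) \<and> even j = b}" "card {j. j div 6 = (q::nat) \<and> even j = b} \<le> 3"
proof -
  obtain x y z where xyz: "{j. j div 6 = q \<and> even j = b} \<subseteq> {x, y, z}"
    using block_parity_subset[of q] by (cases b) auto
  then show "finite {j. j div 6 = q \<and> even j = b}" by (rule finite_subset) simp
  have "card {j. j div 6 = q \<and> even j = b} \<le> card {x, y, z}" using xyz by (intro card_mono) auto
  also have "\<dots> \<le> 3" by (simp add: card_insert_if)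
  finally show "card {j. j div 6 = q \<and> even j = b} \<le> 3" .
qed

lemma subcubic_K33_blocks: "subcubic (K33_blocks n)"
  unfolding subcubic_def
proof
  fix v
  have "out_arcs (with_proj (K33_blocks n)) v
      \<subseteq> Pair v ` {j. j div 6 = v div 6 \<and> even j = (\<not> even v)}"
    by (auto simp: out_arcs_def)
  then have "out_degree (with_proj (K33_blocks n)) v
      \<le> card (Pair v ` {j. j div 6 = v div 6 \<and> even j = (\<not> even v)})"
    unfolding out_degree_def by (intro card_mono finite_imageI card_block_parity)
  also have "\<dots> \<le> card {j. j div 6 = v div 6 \<and> even j = (\<not> even v)}"
    by (intro card_image_le card_block_parity)
  also have "\<dots> \<le> 3" by (rule card_block_parity)
  finally show "out_degree (with_proj (K33_blocks n)) v \<le> 3" .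
qed

text \<open>
  If an indeque set contains two vertices \<open>a\<close> and \<open>b\<close> on different sides of a block, then a third
  vertex \<open>c\<close> of the block would form an induced path with them, the middle vertex being the one of
  \<open>a\<close> and \<open>b\<close> on the side opposite to \<open>c\<close>.
\<close>
lemma indeque_set_block_card:
  assumes "indeque_set (K33_blocks n) S"
  shows "card {s \<in> S. s div 6 = q} \<le> 3"
proof (cases "\<exists>a\<in>S. \<exists>b\<in>S. a div 6 = q \<and> b div 6 = q \<and> even a \<and> odd b")
  case True
  then obtain a b where ab: "a \<in> S" "b \<in> S" "a div 6 = q" "b div 6 = q" "even a" "odd b" by blast
  have S: "S \<subseteq> {..<n}"
    and P3: "\<And>u v w. u \<in> S \<Longrightarrow> v \<in> S \<Longrightarrow> w \<in> S \<Longrightarrow> (u, v) \<in> parcs (K33_blocks n) \<Longrightarrow>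
      (v, w) \<in> parcs (K33_blocks n) \<Longrightarrow> u \<noteq> w \<Longrightarrow> (u, w) \<in> parcs (K33_blocks n)"
    using assms unfolding indeque_set_iff[OF pair_graph_K33_blocks] by auto
  have "c = a \<or> c = b" if "c \<in> S" "c div 6 = q" for c
    using P3[of a b c] P3[of b a c] ab that S by (cases "even c") auto
  then have "{s \<in> S. s div 6 = q} \<subseteq> {a, b}" by blast
  then have "card {s \<in> S. s div 6 = q} \<le> card {a, b}" by (intro card_mono) auto
  also have "\<dots> \<le> 3" by (simp add: card_insert_if)
  finally show ?thesis .
next
  case False
  then obtain p where "{s \<in> S. s div 6 = q} \<subseteq> {j. j div 6 = q \<and> even j = p}" by blast
  then have "card {s \<in> S. s div 6 = q} \<le> card {j. j div 6 = q \<and> even j = p}"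
    by (intro card_mono card_block_parity)
  also have "\<dots> \<le> 3" by (rule card_block_parity)
  finally show ?thesis .
qed

lemma indeque_number_K33_blocks: "indeque_number (K33_blocks n) \<le> 3 * (n div 6 + 1)"
proof (rule indeque_number_le[OF pair_graph_K33_blocks])
  fix S assume S: "indeque_set (K33_blocks n) S"
  then have "S \<subseteq> {..<n}" by (simp add: indeque_set_def)
  then have "S = (\<Union>q\<in>{..n div 6}. {s \<in> S. s div 6 = q})" by (auto intro: div_le_mono)
  then have "card S = card (\<Union>q\<in>{..n div 6}. {s \<in> S. s div 6 = q})" by (rule arg_cong)
  also have "\<dots> \<le> (\<Sum>q\<in>{..n div 6}. card {s \<in> S. s div 6 = q})"
    by (intro card_UN_le) simp
  also have "\<dots> \<le> (\<Sum>q\<in>{..n div 6}. 3)" by (intro sum_mono indeque_set_block_card[OF S])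
  finally show "card S \<le> 3 * (n div 6 + 1)" by simp
qed

section \<open>The indeque ratio\<close>

lemma class_indeque_number_subcubic_bounds:
  "n \<le> 2 * class_indeque_number subcubic_graphs n"
  "2 * class_indeque_number subcubic_graphs n \<le> n + 6"
proof -
  let ?N = "{indeque_number G |G. G \<in> subcubic_graphs \<and> card (pverts G) = n}"
  have "?N \<subseteq> {..n}"
  proof clarsimp
    fix G :: "nat pair_pre_digraph"
    assume "G \<in> subcubic_graphs" "n = card (pverts G)"
    moreover from this interpret pair_graph G by (simp add: subcubic_graphs_def)
    show "indeque_number G \<le> card (pverts G)"
      by (rule indeque_number_le)
        (auto simp: indeque_set_def pair_finite_verts intro: card_mono)
  qed
  then have fin: "finite ?N" by (rule finite_subset) simp
  have block: "indeque_number (K33_blocks n) \<in> ?N"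
    using pair_graph_K33_blocks[of n] subcubic_K33_blocks[of n]
    by (auto simp: subcubic_graphs_def)
  have "Min ?N \<in> ?N" using fin block by (intro Min_in) auto
  then show "n \<le> 2 * class_indeque_number subcubic_graphs n"
    unfolding class_indeque_number_def
    by (auto simp: subcubic_graphs_def dest!: card_le_twice_indeque_number)
  have "class_indeque_number subcubic_graphs n \<le> indeque_number (K33_blocks n)"
    unfolding class_indeque_number_def using fin block by (rule Min_le)
  also have "\<dots> \<le> 3 * (n div 6 + 1)" by (rule indeque_number_K33_blocks)
  finally have "2 * class_indeque_number subcubic_graphs n \<le> 6 * (n div 6) + 6" by simp
  also have "\<dots> \<le> n + 6" by (intro add_right_mono times_div_less_eq_dividend)
  finally show "2 * class_indeque_number subcubic_graphs n \<le> n + 6" .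
qed

theorem theorem3p2:
  shows "(\<lambda>n. real (class_indeque_number subcubic_graphs n) / real n) \<longlonglongrightarrow> 1 / 2
    \<and> indeque_ratio subcubic_graphs = 1 / 2"
proof -
  let ?c = "class_indeque_number subcubic_graphs"
  have "(\<lambda>n. real (?c n) / real n) \<longlonglongrightarrow> 1 / 2"
  proof (rule tendsto_sandwich)
    show "\<forall>\<^sub>F n in sequentially. 1 / 2 \<le> real (?c n) / real n"
      using eventually_gt_at_top[of 0]
    proof eventually_elim
      case (elim n)
      have "real n \<le> 2 * real (?c n)"
        using class_indeque_number_subcubic_bounds(1)[of n] by linarith
      then show ?case using elim by (simp add: field_simps)
    qed
    show "\<forall>\<^sub>F n in sequentially. real (?c n) / real n \<le> 1 / 2 + 3 / real n"
      using eventually_gt_at_top[of 0]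
    proof eventually_elim
      case (elim n)
      have "2 * real (?c n) \<le> real n + 6"
        using class_indeque_number_subcubic_bounds(2)[of n] by linarith
      then show ?case using elim by (simp add: field_simps)
    qed
    show "(\<lambda>n. 1 / 2 + 3 / real n) \<longlonglongrightarrow> 1 / 2"
      using tendsto_add[OF tendsto_const lim_const_over_n[of 3]] by simp
  qed simp
  then show ?thesis unfolding indeque_ratio_def using limI by blast
qed

end
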